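(* For every integer $k\geq 1$ there exists a constant $\epsilon_k>0$ such that for all integers $n\geq k+1$ we have $$r_{k+1,n}\geq \epsilon_k\, n^{k-2}.$$
   Context: For integers $1\leq m\leq n$, let $\Omega_{m,n}$ denote the set of all $m\times n$ real matrices all of whose entries are $\pm1$. For an $m\times n$ matrix $A$ with $m\leq n$, its permanent is $\mathrm{per}(A)=\sum_{\sigma}A_{1\sigma(1)}A_{2\sigma(2)}\cdots A_{m\sigma(m)}$, where the sum ranges over all injective functions $\sigma:\{1,\dots,m\}\to\{1,\dots,n\}$ (for $m=n$ this is the usual permanent). Let $r_{m,n}=|\{\mathrm{per}(A): A\in\Omega_{m,n}\}|$ be the number of distinct values of the permanent on $\Omega_{m,n}$. *)

theory Defs
  imports Jordan_Normal_Form.Matrix "HOL-Library.FuncSet"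
begin

definition sign_matrices :: "nat \<Rightarrow> nat \<Rightarrow> real mat set" where
  "sign_matrices m n =
     {A \<in> carrier_mat m n. \<forall>i<m. \<forall>j<n. A $$ (i, j) = 1 \<or> A $$ (i, j) = -1}"

text \<open>Rows and columns are numbered from 0. The extensional function space makes each
  injection of the row indices into the column indices occur exactly once in the sum.\<close>

definition permanent :: "'a :: comm_semiring_1 mat \<Rightarrow> 'a" where
  "permanent A =
     (\<Sum>\<sigma> | \<sigma> \<in> {..<dim_row A} \<rightarrow>\<^sub>E {..<dim_col A} \<and> inj_on \<sigma> {..<dim_row A}.
        \<Prod>i<dim_row A. A $$ (i, \<sigma> i))"

definition num_permanents :: "nat \<Rightarrow> nat \<Rightarrow> nat" where
  "num_permanents m n = card (permanent ` sign_matrices m n)"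

end

theory Submission
  imports Defs
begin

text \<open>Expanding along the last row \<open>x\<close> gives \<open>per A = (\<Sum>j. x j * per (B - j))\<close>, where
  \<open>B - j\<close> is the rest of \<open>A\<close> without column \<open>j\<close>. Let almost all columns of \<open>B\<close> be all-one,
  and let the remaining ones fall into groups, \<open>q\<close> for each level \<open>l \<le> k\<close>, with \<open>q\<close> a small
  multiple of \<open>n\<close>: a group of level \<open>l\<close> consists of one column for each choice of signs in the
  rows below \<open>l\<close>. If \<open>x\<close> is plus or minus the product of these signs, the group contributes an
  \<open>l\<close>-fold difference of column-deleted permanents. Such a difference has exact order
  \<open>n ^ (k - l)\<close>, because each differencing step strikes out one row. Hence choosing at each level
  how many groups count positively yields mixed-radix expansions with \<open>k + 1\<close> digits up to \<open>q\<close>,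
  and all \<open>(q + 1) ^ (k + 1)\<close> permanents are distinct. This gives the order \<open>n ^ (k + 1)\<close>,
  stronger than the exponent claimed.\<close>

section \<open>Permanents over arbitrary finite row and column sets, and their expansions\<close>

text \<open>With sets as indices, rows and columns can be struck out without renumbering the
  others.\<close>

definition rect_perm :: "'r set \<Rightarrow> 'c set \<Rightarrow> ('r \<Rightarrow> 'c \<Rightarrow> real) \<Rightarrow> real" where
  "rect_perm R C a = (\<Sum>\<sigma> | \<sigma> \<in> R \<rightarrow>\<^sub>E C \<and> inj_on \<sigma> R. \<Prod>i\<in>R. a i (\<sigma> i))"

lemma rect_perm_empty [simp]: "rect_perm {} C a = 1"
  by (simp add: rect_perm_def)

lemma rect_perm_cong:
  assumes "\<And>i j. i \<in> R \<Longrightarrow> j \<in> C \<Longrightarrow> a i j = b i j"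
  shows "rect_perm R C a = rect_perm R C b"
  unfolding rect_perm_def by (intro sum.cong prod.cong refl) (auto intro!: assms)

text \<open>Laplace expansion: an injection on \<open>insert r R\<close> amounts to a value
  \<open>j\<close> at \<open>r\<close> and an injection of \<open>R\<close> into
  \<open>C - {j}\<close>.\<close>

lemma rect_perm_insert:
  assumes "finite R" "finite C" "r \<notin> R"
  shows "rect_perm (insert r R) C a = (\<Sum>j\<in>C. a r j * rect_perm R (C - {j}) a)"
proof -
  let ?I = "\<lambda>R C. {\<sigma>. \<sigma> \<in> R \<rightarrow>\<^sub>E C \<and> inj_on \<sigma> R}"
  have fin: "finite (?I R D)" if "finite D" for D
    using finite_PiE[of R "\<lambda>_. D"] that assms by (auto intro: finite_subset)
  have "(\<Sum>j\<in>C. a r j * rect_perm R (C - {j}) a)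
      = (\<Sum>j\<in>C. \<Sum>\<tau>\<in>?I R (C - {j}). a r j * (\<Prod>i\<in>R. a i (\<tau> i)))"
    by (simp add: rect_perm_def sum_distrib_left)
  also have "\<dots> = (\<Sum>(j, \<tau>)\<in>(SIGMA j:C. ?I R (C - {j})). a r j * (\<Prod>i\<in>R. a i (\<tau> i)))"
    using assms fin by (subst sum.Sigma) auto
  also have "\<dots> = (\<Sum>\<sigma>\<in>?I (insert r R) C. \<Prod>i\<in>insert r R. a i (\<sigma> i))"
  \<comment> \<open>Restricting to \<open>R\<close> resets \<open>r\<close> to
    \<open>undefined\<close>, the value that extensional functions take outside their
    domain.\<close>
  proof (rule sum.reindex_bij_witness
      [where j = "\<lambda>(j, \<tau>). \<tau>(r := j)" and i = "\<lambda>\<sigma>. (\<sigma> r, \<sigma>(r := undefined))"], goal_cases)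
    case (1 p)
    then show ?case using assms(3) by (auto simp: PiE_def extensional_def fun_eq_iff)
  next
    case (2 p)
    obtain j \<tau> where p: "p = (j, \<tau>)" by (cases p)
    then have *: "j \<in> C" "\<tau> \<in> R \<rightarrow>\<^sub>E C - {j}" "inj_on \<tau> R" using 2 by auto
    then have "\<tau>(r := j) \<in> insert r R \<rightarrow>\<^sub>E C" by (intro PiE_fun_upd) auto
    moreover have "j \<notin> \<tau> ` R" using *(2) by auto
    ultimately show ?case
      using * assms(3) by (auto simp: p intro!: inj_on_fun_updI)
  next
    case (3 \<sigma>)
    then show ?case by simp
  next
    case (4 \<sigma>)
    then have *: "\<sigma> \<in> insert r R \<rightarrow>\<^sub>E C" "inj_on \<sigma> R" "\<sigma> r \<notin> \<sigma> ` R"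
      using assms(3) by auto
    have "\<sigma>(r := undefined) \<in> R \<rightarrow>\<^sub>E C - {\<sigma> r}"
    proof (rule PiE_I)
      fix i assume "i \<in> R"
      then show "(\<sigma>(r := undefined)) i \<in> C - {\<sigma> r}"
        using * assms(3) PiE_mem[OF *(1), of i] by (auto simp: image_iff)
    next
      fix i assume "i \<notin> R"
      then show "(\<sigma>(r := undefined)) i = undefined"
        using PiE_arb[OF *(1), of i] by auto
    qed
    moreover have "inj_on (\<sigma>(r := undefined)) R"
      using *(2) assms(3) by (metis fun_upd_other inj_on_cong)
    moreover have "\<sigma> r \<in> C" using PiE_mem[OF *(1)] by auto
    ultimately show ?case by simp
  next
    case (5 p)
    obtain j \<tau> where p: "p = (j, \<tau>)" by (cases p)
    have "(\<Prod>i\<in>R. a i ((\<tau>(r := j)) i)) = (\<Prod>i\<in>R. a i (\<tau> i))"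
      using assms(3) by (intro prod.cong) auto
    then show ?case using assms by (simp add: p)
  qed
  finally show ?thesis by (simp add: rect_perm_def)
qed

text \<open>An injection either avoids column \<open>j\<close> or takes it in exactly one row
  \<open>i\<close>. The induction obtains this from row expansions instead of a second
  bijection.\<close>

lemma rect_perm_remove_column:
  assumes "finite R" "finite C" "j \<in> C"
  shows "rect_perm R C a
    = rect_perm R (C - {j}) a + (\<Sum>i\<in>R. a i j * rect_perm (R - {i}) (C - {j}) a)"
  using assms
proof (induction R arbitrary: C rule: finite_induct)
  case empty
  then show ?case by simp
next
  case (insert r R)
  have swap: "C - {j'} - {j} = C - {j} - {j'}" for j' by auto
  have ins: "insert r R - {i} = insert r (R - {i})" if "i \<in> R" for i
    using that insert.hyps by auto
  have "rect_perm (insert r R) C a = (\<Sum>j'\<in>C. a r j' * rect_perm R (C - {j'}) a)"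
    using insert by (simp add: rect_perm_insert)
  also have "\<dots> = a r j * rect_perm R (C - {j}) a
      + (\<Sum>j'\<in>C - {j}. a r j' * rect_perm R (C - {j'}) a)"
    using insert.prems by (simp add: sum.remove)
  also have "(\<Sum>j'\<in>C - {j}. a r j' * rect_perm R (C - {j'}) a)
      = (\<Sum>j'\<in>C - {j}. a r j' * rect_perm R (C - {j} - {j'}) a
          + (\<Sum>i\<in>R. a i j * (a r j' * rect_perm (R - {i}) (C - {j} - {j'}) a)))"
  proof (intro sum.cong refl)
    fix j' assume "j' \<in> C - {j}"
    then have "rect_perm R (C - {j'}) a = rect_perm R (C - {j} - {j'}) a
        + (\<Sum>i\<in>R. a i j * rect_perm (R - {i}) (C - {j} - {j'}) a)"
      using insert.IH[of "C - {j'}"] insert.prems by (auto simp: swap)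
    then show "a r j' * rect_perm R (C - {j'}) a = a r j' * rect_perm R (C - {j} - {j'}) a
          + (\<Sum>i\<in>R. a i j * (a r j' * rect_perm (R - {i}) (C - {j} - {j'}) a))"
      by (simp add: distrib_left sum_distrib_left mult.left_commute)
  qed
  also have "\<dots> = rect_perm (insert r R) (C - {j}) a
      + (\<Sum>i\<in>R. a i j * rect_perm (insert r R - {i}) (C - {j}) a)"
  proof -
    have "(\<Sum>j'\<in>C - {j}. \<Sum>i\<in>R. a i j * (a r j' * rect_perm (R - {i}) (C - {j} - {j'}) a))
        = (\<Sum>i\<in>R. a i j * rect_perm (insert r R - {i}) (C - {j}) a)"
      using insert.hyps insert.prems
      by (subst sum.swap) (auto simp: ins rect_perm_insert sum_distrib_left intro!: sum.cong)
    then show ?thesis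
      using insert.hyps insert.prems by (simp add: sum.distrib rect_perm_insert)
  qed
  finally show ?case using insert.hyps by simp
qed

text \<open>By the previous expansion, both sides are \<open>rect_perm R C a\<close> minus terms
  with one row fewer, which agree by induction. So only the sign pattern of the deleted column
  matters.\<close>

lemma rect_perm_remove_column_cong:
  assumes "finite R" "finite C" "j \<in> C" "j' \<in> C" "\<And>i. i \<in> R \<Longrightarrow> a i j = a i j'"
  shows "rect_perm R (C - {j}) a = rect_perm R (C - {j'}) a"
  using assms
proof (induction R rule: finite_psubset_induct)
  case (psubset R)
  have "(\<Sum>i\<in>R. a i j * rect_perm (R - {i}) (C - {j}) a)
      = (\<Sum>i\<in>R. a i j' * rect_perm (R - {i}) (C - {j'}) a)"
    using psubset by (intro sum.cong refl arg_cong2[of _ _ _ _ "(*)"] psubset.IH) auto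
  then show ?case
    using rect_perm_remove_column[of R C j a] rect_perm_remove_column[of R C j' a] psubset
    by auto
qed

section \<open>Size bounds for permanents\<close>

lemma abs_rect_perm_le:
  assumes "finite R" "finite C" "real (card C) \<le> N"
    and "\<And>i j. i \<in> R \<Longrightarrow> j \<in> C \<Longrightarrow> \<bar>a i j\<bar> \<le> 1"
  shows "\<bar>rect_perm R C a\<bar> \<le> N ^ card R"
  using assms
proof (induction R arbitrary: C rule: finite_induct)
  case empty
  then show ?case by simp
next
  case (insert r R)
  have N: "N \<ge> 0" using insert.prems(2) by linarith
  have "\<bar>rect_perm (insert r R) C a\<bar> \<le> (\<Sum>j\<in>C. \<bar>a r j * rect_perm R (C - {j}) a\<bar>)"
    using insert by (simp add: rect_perm_insert)
  also have "\<dots> \<le> (\<Sum>j\<in>C. 1 * N ^ card R)"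
  proof (intro sum_mono)
    fix j assume j: "j \<in> C"
    then have "real (card (C - {j})) \<le> N"
      using insert.prems card_Diff1_le[of C j] by linarith
    then have "\<bar>rect_perm R (C - {j}) a\<bar> \<le> N ^ card R"
      using insert.prems by (intro insert.IH) auto
    then show "\<bar>a r j * rect_perm R (C - {j}) a\<bar> \<le> 1 * N ^ card R"
      unfolding abs_mult using insert.prems j by (intro mult_mono) auto
  qed
  also have "\<dots> \<le> N * N ^ card R"
    using insert.prems N by (simp add: mult_right_mono)
  finally show ?case using insert.hyps by simp
qed

text \<open>\<open>Z\<close> holds the exceptional columns, at most a fraction
  \<open>\<beta>\<close> of \<open>N\<close>. In a row expansion the good columns contribute nearly
  \<open>N ^ m\<close> each and the bad ones at least \<open>- (N ^ m)\<close>, so each row costs at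
  most \<open>2 * \<beta>\<close>. The slack \<open>card R\<close> pays for the one good column that
  each expansion may strike out.\<close>

lemma rect_perm_ge:
  assumes "finite R" "finite C" "real (card C) \<le> N"
    and "(1 - \<beta>) * N + real (card R) \<le> real (card (C - Z))"
    and "\<And>i j. i \<in> R \<Longrightarrow> j \<in> C \<Longrightarrow> \<bar>a i j\<bar> \<le> 1"
    and "\<And>i j. i \<in> R \<Longrightarrow> j \<in> C - Z \<Longrightarrow> a i j = 1"
    and "0 \<le> \<beta>" "2 * \<beta> * real (card R) \<le> 1"
  shows "(1 - 2 * \<beta> * real (card R)) * N ^ card R \<le> rect_perm R C a"
  using assms
proof (induction R arbitrary: C rule: finite_induct)
  case empty
  then show ?case by simp
next
  case (insert r R)
  define m where "m = card R"
  have card: "card (insert r R) = Suc m" using insert.hyps by (simp add: m_def)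
  define c where "c = (1 - 2 * \<beta> * m) * N ^ m"
  have N: "N \<ge> 0" using insert.prems(2) by linarith
  have c0: "2 * \<beta> * m \<le> 1"
    using insert.prems(6,7) unfolding card by (simp add: algebra_simps)
  have cardC: "card (C - {j}) \<le> card C" "card (C - Z) \<le> Suc (card (C - {j} - Z))" for j
  proof -
    show "card (C - {j}) \<le> card C" by (rule card_Diff1_le)
    have "C - {j} - Z = (C - Z) - {j}" by auto
    then show "card (C - Z) \<le> Suc (card (C - {j} - Z))"
      using card_Diff_singleton_if[of "C - Z" j] insert.prems by auto
  qed
  have ge: "c \<le> rect_perm R (C - {j}) a" if "j \<in> C - Z" for j
    unfolding c_def m_def
  proof (rule insert.IH)
    show "real (card (C - {j})) \<le> N" using cardC(1)[of j] insert.prems(2) by linarith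
    show "(1 - \<beta>) * N + real (card R) \<le> real (card (C - {j} - Z))"
      using cardC(2)[of j] insert.prems(3) unfolding card m_def by simp
    show "2 * \<beta> * real (card R) \<le> 1" using c0 by (simp add: m_def)
  qed (use insert.prems in auto)
  have bad: "- (N ^ m) \<le> a r j * rect_perm R (C - {j}) a" if "j \<in> C" for j
  proof -
    have "\<bar>rect_perm R (C - {j}) a\<bar> \<le> N ^ m" unfolding m_def
      using insert.hyps insert.prems cardC(1)[of j] by (intro abs_rect_perm_le) auto
    then have "\<bar>a r j * rect_perm R (C - {j}) a\<bar> \<le> 1 * N ^ m"
      unfolding abs_mult using insert.prems that by (intro mult_mono) auto
    then show ?thesis by linarith
  qed
  have split: "C = (C - Z) \<union> (C \<inter> Z)" by auto
  have cs: "real (card C) = real (card (C - Z)) + real (card (C \<inter> Z))"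
    using insert.prems by (subst split, subst card_Un_disjoint) auto
  have g: "(1 - \<beta>) * N \<le> real (card (C - Z))" using insert.prems(3) by simp
  have b: "real (card (C \<inter> Z)) \<le> \<beta> * N"
    using g cs insert.prems(2) by (simp add: algebra_simps)
  \<comment> \<open>The summand with the square of \<open>\<beta>\<close> makes the identity exact;
    being nonpositive, it is dropped in the next step.\<close>
  have "(1 - 2 * \<beta> * real (card (insert r R))) * N ^ card (insert r R)
      = ((1 - \<beta>) * (1 - 2 * \<beta> * m) - \<beta> - 2 * \<beta>\<^sup>2 * m) * (N * N ^ m)"
    unfolding card by (simp add: algebra_simps power2_eq_square)
  also have "\<dots> \<le> ((1 - \<beta>) * (1 - 2 * \<beta> * m) - \<beta>) * (N * N ^ m)"
    using N by (intro mult_right_mono) auto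
  also have "\<dots> = (1 - \<beta>) * N * c - \<beta> * N * N ^ m"
    by (simp add: c_def algebra_simps)
  also have "\<dots> \<le> real (card (C - Z)) * c - real (card (C \<inter> Z)) * N ^ m"
    using g b c0 N by (intro diff_mono mult_right_mono) (auto simp: c_def)
  also have "\<dots> = (\<Sum>j\<in>C - Z. c) + (\<Sum>j\<in>C \<inter> Z. - (N ^ m))" by simp
  also have "\<dots> \<le> (\<Sum>j\<in>C - Z. a r j * rect_perm R (C - {j}) a)
      + (\<Sum>j\<in>C \<inter> Z. a r j * rect_perm R (C - {j}) a)"
    using ge bad insert.prems by (intro add_mono sum_mono) auto
  also have "\<dots> = (\<Sum>j\<in>C. a r j * rect_perm R (C - {j}) a)"
    using insert.prems by (subst (3) split, subst sum.union_disjoint) auto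
  also have "\<dots> = rect_perm (insert r R) C a"
    using insert by (simp add: rect_perm_insert)
  finally show ?case .
qed

section \<open>Alternating differences of column-deleted permanents\<close>

text \<open>The sum expands a product of factors \<open>1 - 1\<close>. It cancels the part of a
  difference that does not depend on the deleted column.\<close>

lemma sum_Pow_alternating:
  assumes "finite T" "T \<noteq> {}"
  shows "(\<Sum>X\<in>Pow T. (- 1 :: real) ^ card (T - X)) = 0"
proof -
  have "(\<Sum>X\<in>Pow T. (- 1 :: real) ^ card (T - X)) = (\<Sum>X\<in>Pow T. (- 1) ^ (card T - card X))"
    using assms by (intro sum.cong refl) (auto simp: card_Diff_subset finite_subset)
  also have "\<dots> = (\<Prod>i\<in>T. (1 :: real) - 1)"
    using assms by (subst prod_diff_conv_sum') auto
  finally show ?thesis using assms by (simp add: card_gt_0_iff)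
qed

text \<open>The column \<open>c X\<close> stands for the one with entry \<open>- 1\<close> exactly in the rows of \<open>X\<close>.\<close>

definition cube_diff :: "'r set \<Rightarrow> 'c set \<Rightarrow> ('r \<Rightarrow> 'c \<Rightarrow> real) \<Rightarrow> ('r set \<Rightarrow> 'c) \<Rightarrow> 'r set \<Rightarrow> real"
  where "cube_diff R C a c T
    = (\<Sum>X\<in>Pow T. (- 1) ^ card (T - X) * rect_perm R (C - {c X}) a)"

locale column_cube =
  fixes U :: "'r set" and C :: "'c set" and a :: "'r \<Rightarrow> 'c \<Rightarrow> real" and c :: "'r set \<Rightarrow> 'c"
  assumes finU: "finite U" and finC: "finite C"
    and mem: "X \<subseteq> U \<Longrightarrow> c X \<in> C"
    and entry: "X \<subseteq> U \<Longrightarrow> i \<in> U \<Longrightarrow> a i (c X) = (if i \<in> X then - 1 else 1)"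
begin

text \<open>Expand each summand by \<open>rect_perm_remove_column\<close>; the constant term
  \<open>rect_perm R C a\<close> cancels. A row \<open>i\<close> outside \<open>T\<close> has entry
  1 in all columns involved and is merely struck out. For \<open>i\<close> in \<open>T\<close>,
  passing from \<open>X\<close> to \<open>insert i X\<close> flips both the sign and the entry, so
  the two terms add up: this gives the factor 2 and lowers the order of the difference.\<close>

lemma cube_diff_rec:
  assumes "T \<subseteq> R" "R \<subseteq> U" "T \<noteq> {}"
  shows "cube_diff R C a c T = 2 * (\<Sum>i\<in>T. cube_diff (R - {i}) C a c (T - {i}))
    - (\<Sum>i\<in>R - T. cube_diff (R - {i}) C a c T)"
proof -
  have fin: "finite R" "finite T"
    using assms finU by (meson finite_subset subset_trans)+
  let ?s = "\<lambda>T X. (- 1 :: real) ^ card (T - X)"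
  let ?p = "\<lambda>i X. rect_perm (R - {i}) (C - {c X}) a"
  define f where "f i = (\<Sum>X\<in>Pow T. ?s T X * (a i (c X) * ?p i X))" for i
  have "cube_diff R C a c T = (\<Sum>X\<in>Pow T. ?s T X * (rect_perm R C a
      - (\<Sum>i\<in>R. a i (c X) * ?p i X)))"
    unfolding cube_diff_def
  proof (intro sum.cong refl)
    fix X assume "X \<in> Pow T"
    then have "c X \<in> C" using assms by (intro mem) auto
    then show "?s T X * rect_perm R (C - {c X}) a
        = ?s T X * (rect_perm R C a - (\<Sum>i\<in>R. a i (c X) * ?p i X))"
      using rect_perm_remove_column[of R C "c X" a] fin finC by simp
  qed
  also have "\<dots> = (\<Sum>X\<in>Pow T. ?s T X) * rect_perm R C a
      - (\<Sum>X\<in>Pow T. \<Sum>i\<in>R. ?s T X * (a i (c X) * ?p i X))"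
    by (simp add: right_diff_distrib sum_subtractf sum_distrib_left sum_distrib_right)
  also have "(\<Sum>X\<in>Pow T. \<Sum>i\<in>R. ?s T X * (a i (c X) * ?p i X)) = (\<Sum>i\<in>R. f i)"
    unfolding f_def by (rule sum.swap)
  also have "\<dots> = (\<Sum>i\<in>T. f i) + (\<Sum>i\<in>R - T. f i)"
    using assms fin by (metis add.commute sum.subset_diff)
  also have "(\<Sum>i\<in>R - T. f i) = (\<Sum>i\<in>R - T. cube_diff (R - {i}) C a c T)"
  proof (intro sum.cong refl)
    fix i assume i: "i \<in> R - T"
    have "a i (c X) = 1" if "X \<in> Pow T" for X
      using that i assms by (subst entry) auto
    then show "f i = cube_diff (R - {i}) C a c T"
      unfolding f_def cube_diff_def by (intro sum.cong) auto
  qed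
  also have "(\<Sum>i\<in>T. f i) = (\<Sum>i\<in>T. - 2 * cube_diff (R - {i}) C a c (T - {i}))"
  proof (intro sum.cong refl)
    fix i assume i: "i \<in> T"
    then have Ti: "T = insert i (T - {i})" by auto
    have inj: "inj_on (insert i) (Pow (T - {i}))" by (auto simp: inj_on_def)
    have "f i = (\<Sum>X\<in>Pow (T - {i}). ?s T X * (a i (c X) * ?p i X))
        + (\<Sum>X\<in>Pow (T - {i}). ?s T (insert i X) * (a i (c (insert i X)) * ?p i (insert i X)))"
      unfolding f_def using fin inj
      by (subst (1) Ti, subst Pow_insert, subst sum.union_disjoint)
         (auto simp: sum.reindex[OF inj])
    also have "\<dots> = (\<Sum>X\<in>Pow (T - {i}). - 2 * (?s (T - {i}) X * ?p i X))"
      unfolding sum.distrib[symmetric]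
    proof (intro sum.cong refl)
      fix X assume X: "X \<in> Pow (T - {i})"
      have U: "X \<subseteq> U" "insert i X \<subseteq> U" "i \<in> U" using X i assms by auto
      have "T - X = insert i (T - {i} - X)" using X i by auto
      then have 1: "?s T X = - ?s (T - {i}) X" using fin by simp
      have 2: "T - insert i X = T - {i} - X" by auto
      \<comment> \<open>The two deleted columns differ only in row \<open>i\<close>, which is struck
        out here.\<close>
      have 3: "?p i (insert i X) = ?p i X"
        using fin finC U assms
        by (intro rect_perm_remove_column_cong mem) (auto simp: entry)
      have 4: "a i (c X) = 1" "a i (c (insert i X)) = - 1"
        using X U by (auto simp: entry)
      show "?s T X * (a i (c X) * ?p i X)
          + ?s T (insert i X) * (a i (c (insert i X)) * ?p i (insert i X))
          = - 2 * (?s (T - {i}) X * ?p i X)"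
        unfolding 1 2 3 4 by simp
    qed
    finally show "f i = - 2 * cube_diff (R - {i}) C a c (T - {i})"
      by (simp add: cube_diff_def sum_distrib_left)
  qed
  finally show ?thesis
    using sum_Pow_alternating[of T] fin assms by (simp add: sum_distrib_left sum_negf)
qed

text \<open>In the recursion, the sum over \<open>T\<close> keeps the exponent
  \<open>card (R - T)\<close> and has positive terms, while the sum over \<open>R - T\<close> has
  exponent one less, so that a large \<open>N\<close> makes it a minor term. The hypotheses
  \<open>le\<close> and \<open>ge\<close> settle the base case \<open>T = {}\<close>.\<close>

lemma cube_diff_bounds:
  fixes N D :: real
  defines "D \<equiv> real (card U) + 1"
  assumes "T \<subseteq> R" "R \<subseteq> U"
    and le: "\<And>R. R \<subseteq> U \<Longrightarrow> \<bar>rect_perm R (C - {c {}}) a\<bar> \<le> N ^ card R"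
    and ge: "\<And>R. R \<subseteq> U \<Longrightarrow> N ^ card R / 2 \<le> rect_perm R (C - {c {}}) a"
    and N: "2 * D * (3 * D) ^ card U \<le> N"
  shows "cube_diff R C a c T \<le> (3 * D) ^ card R * N ^ card (R - T) \<and>
    N ^ card (R - T) / 2 \<le> cube_diff R C a c T"
proof -
  have "finite R" using assms finU by (auto intro: finite_subset)
  then show ?thesis using assms(2,3)
  proof (induction R arbitrary: T rule: finite_psubset_induct)
    case (psubset R)
    have finT: "finite T" using psubset by (auto intro: finite_subset)
    have D: "D \<ge> 1" by (simp add: D_def)
    have "1 * 1 \<le> 2 * D * (3 * D) ^ card U"
      using D by (intro mult_mono one_le_power) auto
    then have N1: "N \<ge> 1" using N by linarith
    show ?case
    proof (cases "T = {}")
      case True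
      have "cube_diff R C a c T = rect_perm R (C - {c {}}) a"
        by (simp add: True cube_diff_def)
      moreover have "1 * N ^ card R \<le> (3 * D) ^ card R * N ^ card R"
        using D N1 by (intro mult_right_mono one_le_power) auto
      ultimately show ?thesis
        using le[of R] ge[of R] psubset.prems by (auto simp: True)
    next
      case False
      define r where "r = card (R - T)"
      \<comment> \<open>\<open>K\<close> is the upper constant that the induction hypothesis
        supplies for one row fewer.\<close>
      define K where "K = (3 * D) ^ (card R - 1)"
      define A where "A = (\<Sum>i\<in>T. cube_diff (R - {i}) C a c (T - {i}))"
      define B where "B = (\<Sum>i\<in>R - T. cube_diff (R - {i}) C a c T)"
      have eq: "cube_diff R C a c T = 2 * A - B"
        unfolding A_def B_def using psubset.prems False by (intro cube_diff_rec) auto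
      have cR: "card (R - {i}) = card R - 1" if "i \<in> R" for i using that by simp
      have cRT: "card R > 0" using False psubset by (auto simp: card_gt_0_iff)
      have K1: "1 \<le> K" unfolding K_def using D by (intro one_le_power) auto
      have KU: "K \<le> (3 * D) ^ card U"
        unfolding K_def using D psubset.prems card_mono[OF finU, of R]
        by (intro power_increasing) auto
      have KR: "(3 * D) ^ card R = 3 * D * K"
        unfolding K_def using cRT by (metis Suc_diff_1 power_Suc)
      have tD: "real (card T) \<le> D" "real r \<le> D"
        using psubset.prems card_mono[OF finU, of T] card_mono[OF finU, of "R - T"]
          order_trans[OF psubset.prems]
        by (force simp: D_def r_def)+
      have IH1: "cube_diff (R - {i}) C a c (T - {i}) \<le> K * N ^ r \<and>
          N ^ r / 2 \<le> cube_diff (R - {i}) C a c (T - {i})" if "i \<in> T" for i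
      proof -
        have "i \<in> R" "R - {i} - (T - {i}) = R - T" using that psubset.prems by auto
        then show ?thesis
          using psubset.IH[of "R - {i}" "T - {i}"] psubset.prems cR[of i]
          by (auto simp: r_def K_def simp del: card_Diff_insert card_Diff_singleton)
      qed
      have IH2: "cube_diff (R - {i}) C a c T \<le> K * N ^ (r - 1) \<and>
          N ^ (r - 1) / 2 \<le> cube_diff (R - {i}) C a c T" if "i \<in> R - T" for i
      proof -
        have "R - {i} - T = (R - T) - {i}" by auto
        then have "card (R - {i} - T) = r - 1" using that by (simp add: r_def)
        then show ?thesis
          using psubset.IH[of "R - {i}" T] psubset.prems that cR[of i]
          by (auto simp: K_def)
      qed
      have "A \<le> (\<Sum>i\<in>T. K * N ^ r)" unfolding A_def using IH1 by (intro sum_mono) auto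
      also have "\<dots> \<le> D * (K * N ^ r)"
        using tD K1 N1 by (simp add: mult_right_mono)
      finally have A_le: "A \<le> D * (K * N ^ r)" .
      have "1 * (N ^ r / 2) \<le> real (card T) * (N ^ r / 2)"
        using False finT N1 by (intro mult_right_mono) (auto simp: Suc_le_eq card_gt_0_iff)
      also have "\<dots> = (\<Sum>i\<in>T. N ^ r / 2)" by simp
      also have "\<dots> \<le> A" unfolding A_def using IH1 by (intro sum_mono) auto
      finally have A_ge: "N ^ r / 2 \<le> A" by simp
      have "0 \<le> N ^ (r - 1) / 2" using N1 by simp
      then have B_ge: "0 \<le> B"
        unfolding B_def using IH2 by (intro sum_nonneg) force
      \<comment> \<open>Each of the at most \<open>D\<close> terms lacks one factor
        \<open>N\<close>, which the lower bound on \<open>N\<close> turns into a gain. For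
        \<open>r = 0\<close> the exponent \<open>r - 1\<close> is truncated, but then the sum is
        empty.\<close>
      have B_le: "B \<le> N ^ r / 2"
      proof (cases "r = 0")
        case True
        then have "R - T = {}" using psubset by (simp add: r_def)
        then have "B = 0" by (simp only: B_def sum.empty)
        then show ?thesis using N1 by simp
      next
        case r: False
        have "B \<le> (\<Sum>i\<in>R - T. K * N ^ (r - 1))"
          unfolding B_def using IH2 by (intro sum_mono) auto
        also have "\<dots> = real r * (K * N ^ (r - 1))" by (simp add: r_def)
        also have "\<dots> \<le> D * ((3 * D) ^ card U * N ^ (r - 1))"
          using tD D KU K1 N1 by (intro mult_mono) auto
        also have "\<dots> = (2 * D * (3 * D) ^ card U) / 2 * N ^ (r - 1)" by simp
        also have "\<dots> \<le> N / 2 * N ^ (r - 1)"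
          using N N1 by (intro mult_right_mono divide_right_mono) auto
        also have "\<dots> = N ^ r / 2" using r by (simp add: power_eq_if)
        finally show ?thesis .
      qed
      have "0 \<le> D * (K * N ^ r)" using D K1 N1 by simp
      then have "2 * A - B \<le> 3 * D * K * N ^ r" using A_le B_ge by (simp add: algebra_simps)
      then show ?thesis
        using A_ge B_le unfolding eq KR r_def[symmetric] by linarith
    qed
  qed
qed

end

section \<open>Uniqueness of mixed-radix expansions\<close>

text \<open>Digit 0 is the most significant. At the first index where the digits differ, the
  difference is at least 1 in absolute value, and the later digits, differing by at most
  \<open>q\<close>, cannot make up for it.\<close>

lemma mixed_radix_inj:
  fixes w :: "nat \<Rightarrow> real"
  assumes dom: "\<And>l. l \<le> k \<Longrightarrow> real q * (\<Sum>l'\<in>{l<..k}. \<bar>w l'\<bar>) < \<bar>w l\<bar>"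
    and t: "t \<in> {..k} \<rightarrow>\<^sub>E {..q}" and u: "u \<in> {..k} \<rightarrow>\<^sub>E {..q}"
    and eq: "(\<Sum>l\<le>k. real (t l) * w l) = (\<Sum>l\<le>k. real (u l) * w l)"
  shows "t = u"
proof (rule ccontr)
  assume "t \<noteq> u"
  then have ex: "\<exists>l. l \<le> k \<and> t l \<noteq> u l"
    using t u by (metis PiE_ext atMost_iff)
  define l where "l = (LEAST l. l \<le> k \<and> t l \<noteq> u l)"
  have l: "l \<le> k" "t l \<noteq> u l"
    using LeastI_ex[OF ex] by (auto simp: l_def)
  have less: "t l' = u l'" if "l' < l" for l'
    using not_less_Least[of l' "\<lambda>l. l \<le> k \<and> t l \<noteq> u l"] that l by (auto simp: l_def)
  define d where "d i = real (t i) - real (u i)" for i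
  have dq: "\<bar>d i\<bar> \<le> real q" if "i \<le> k" for i
    using PiE_mem[OF t, of i] PiE_mem[OF u, of i] that by (auto simp: d_def)
  have split: "{..k} = {..<l} \<union> ({l} \<union> {l<..k})" using l by auto
  have "0 = (\<Sum>i\<le>k. d i * w i)"
    using eq by (simp add: d_def left_diff_distrib sum_subtractf)
  also have "\<dots> = (\<Sum>i<l. d i * w i) + (d l * w l + (\<Sum>i\<in>{l<..k}. d i * w i))"
    by (subst split, subst sum.union_disjoint, simp, simp, force, subst sum.union_disjoint) auto
  also have "(\<Sum>i<l. d i * w i) = 0" using less by (simp add: d_def)
  finally have "\<bar>d l * w l\<bar> = \<bar>\<Sum>i\<in>{l<..k}. d i * w i\<bar>" by simp
  also have "\<dots> \<le> (\<Sum>i\<in>{l<..k}. \<bar>d i * w i\<bar>)" by (rule sum_abs)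
  also have "\<dots> \<le> (\<Sum>i\<in>{l<..k}. real q * \<bar>w i\<bar>)"
    unfolding abs_mult using dq by (intro sum_mono mult_right_mono) auto
  also have "\<dots> < \<bar>w l\<bar>" using dom[OF l(1)] by (simp add: sum_distrib_left)
  also have "1 * \<bar>w l\<bar> \<le> \<bar>d l * w l\<bar>"
    unfolding abs_mult using l(2) by (intro mult_right_mono) (auto simp: d_def)
  finally show False by simp
qed

section \<open>Sign matrices and their permanents: finiteness and positivity of the count\<close>

lemma finite_sign_matrices: "finite (sign_matrices m n)"
proof (rule finite_subset)
  let ?F = "{..<m} \<times> {..<n} \<rightarrow>\<^sub>E {1, - 1 :: real}"
  show "sign_matrices m n \<subseteq> mat m n ` ?F"
  proof
    fix A assume A: "A \<in> sign_matrices m n"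
    have "A = mat m n (restrict (($$) A) ({..<m} \<times> {..<n}))"
      using A by (intro eq_matI) (auto simp: sign_matrices_def)
    moreover have "restrict (($$) A) ({..<m} \<times> {..<n}) \<in> ?F"
      using A by (auto simp: sign_matrices_def)
    ultimately show "A \<in> mat m n ` ?F" by blast
  qed
qed (auto intro: finite_PiE)

text \<open>This covers the \<open>n\<close> below the threshold of
  \<open>num_permanents_ge\<close>. Finiteness enters because \<open>card\<close> is 0 on infinite
  sets.\<close>

lemma num_permanents_pos:
  assumes "m \<le> n"
  shows "num_permanents m n > 0"
proof -
  have "mat m n (\<lambda>_. 1) \<in> sign_matrices m n" by (auto simp: sign_matrices_def)
  then show ?thesis
    unfolding num_permanents_def using finite_sign_matrices by (auto simp: card_gt_0_iff)
qed

section \<open>A family of sign matrices with many distinct permanents\<close>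

text \<open>With \<open>q = n div M\<close>, the constant \<open>M\<close> serves three ends: the
  exceptional columns number at most \<open>n / (8 * D)\<close>, \<open>n\<close> passes the
  threshold of \<open>cube_diff_bounds\<close>, and \<open>q * D * L\<close> stays below
  \<open>n / 2\<close>, so that each weight dominates the later ones.\<close>

lemma num_permanents_ge:
  fixes k n :: nat
  defines "M \<equiv> 8 * (k + 1)\<^sup>2 * 2 ^ k * (3 * (k + 1)) ^ k"
  assumes "M \<le> n"
  shows "(real n / real M) ^ (k + 1) \<le> real (num_permanents (k + 1) n)"
proof -
  define D where "D = real k + 1"
  define L where "L = (3 * D) ^ k"
  define q where "q = n div M"
  have D1: "D \<ge> 1" and L1: "L \<ge> 1" by (auto simp: D_def L_def)
  have M_eq: "real M = 8 * D\<^sup>2 * 2 ^ k * L"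
    by (simp add: M_def D_def L_def add.commute)
  have M_pos: "M > 0" by (simp add: M_def)
  have q1: "q \<ge> 1" using assms(2) M_pos unfolding q_def by (simp add: div_greater_zero_iff Suc_le_eq)
  have qM: "real q * real M \<le> real n"
    unfolding q_def of_nat_mult[symmetric] of_nat_le_iff by simp
  have nM: "8 * D\<^sup>2 * 2 ^ k * L \<le> real n" using assms(2) M_eq by linarith
  have n_pos: "n > 0" using assms(2) M_pos by linarith

  \<comment> \<open>An index \<open>(l, s, X)\<close> stands for level, number of the group, and set
    of rows with entry \<open>- 1\<close>. The injection \<open>e\<close> below places these columns
    among the \<open>n\<close> available ones.\<close>
  define I where "I = (SIGMA l:{..k}. {..<q} \<times> Pow {..<l})"
  have finI: "finite I" by (auto simp: I_def)
  have "card I \<le> card ({..k} \<times> {..<q} \<times> Pow {..<k})"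
    unfolding I_def by (intro card_mono) auto
  then have "real (card I) \<le> real ((k + 1) * (q * 2 ^ k))"
    by (simp only: of_nat_le_iff card_cartesian_product card_Pow) (simp add: card_Pow)
  also have "real ((k + 1) * (q * 2 ^ k)) = D * (real q * 2 ^ k)"
    by (simp add: D_def algebra_simps)
  finally have "8 * D * real (card I) \<le> 8 * D * (D * (real q * 2 ^ k))"
    using D1 by (intro mult_left_mono) auto
  also have "\<dots> = real q * (8 * D\<^sup>2 * 2 ^ k * 1)"
    by (simp add: power2_eq_square)
  also have "\<dots> \<le> real q * (8 * D\<^sup>2 * 2 ^ k * L)"
    using L1 by (intro mult_left_mono) auto
  finally have cardI: "8 * D * real (card I) \<le> real n" using qM unfolding M_eq by linarith
  have "1 * real (card I) \<le> 8 * D * real (card I)"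
    using D1 by (intro mult_right_mono) auto
  then have "card I \<le> card {..<n}" using cardI by simp
  then obtain e where e: "e ` I \<subseteq> {..<n}" "inj_on e I"
    using card_le_inj[OF finI, of "{..<n}"] by auto
  define g where "g = the_inv_into I e"
  have g: "g (e p) = p" if "p \<in> I" for p
    using that e(2) by (simp add: g_def the_inv_into_f_f)
  define a where "a i j = (if j \<in> e ` I \<and> i \<in> snd (snd (g j)) then - 1 else 1 :: real)"
    for i j
  have a_e: "a i (e (l, s, X)) = (if i \<in> X then - 1 else 1)" if "(l, s, X) \<in> I" for i l s X
    using that g[OF that] by (simp add: a_def)
  \<comment> \<open>Group 0 of level \<open>k\<close> contains every sign pattern and so provides
    reference columns for all levels; it exists because \<open>q\<close> is positive.\<close>
  define c where "c X = e (k, 0, X)" for X :: "nat set"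
  have cI: "(k, 0, X) \<in> I" if "X \<subseteq> {..<k}" for X
    using that q1 by (auto simp: I_def)
  interpret column_cube "{..<k}" "{..<n}" a c
  proof
    fix X :: "nat set" and i :: nat assume "X \<subseteq> {..<k}"
    from cI[OF this] show "c X \<in> {..<n}" "a i (c X) = (if i \<in> X then - 1 else 1)"
      using e(1) a_e by (auto simp: c_def)
  qed auto
  \<comment> \<open>\<open>Q j\<close> is the cofactor of entry \<open>j\<close> of the last row,
    and \<open>w l\<close> is the weight of one group of level \<open>l\<close>.\<close>
  define Q where "Q j = rect_perm {..<k} ({..<n} - {j}) a" for j
  define w where "w l = cube_diff {..<k} {..<n} a c {..<l}" for l

  have card1: "card ({..<n} - {c {}}) = n - 1" using mem[of "{}"] by simp
  have w_bounds: "w l \<le> L * real n ^ (k - l) \<and> real n ^ (k - l) / 2 \<le> w l" if "l \<le> k" for l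
  proof -
    have "w l \<le> (3 * (real (card {..<k}) + 1)) ^ card {..<k} * real n ^ card ({..<k} - {..<l}) \<and>
        real n ^ card ({..<k} - {..<l}) / 2 \<le> w l"
      unfolding w_def
    proof (rule cube_diff_bounds)
      show "{..<l} \<subseteq> {..<k}" using that by auto
      show "2 * (real (card {..<k}) + 1) * (3 * (real (card {..<k}) + 1)) ^ card {..<k} \<le> real n"
      proof -
        have "2 * D * L \<le> 8 * D\<^sup>2 * 2 ^ k * L"
        proof (rule mult_right_mono)
          have "1 * 1 * D \<le> D * 2 ^ k * D" using D1 by (intro mult_mono) auto
          then show "2 * D \<le> 8 * D\<^sup>2 * 2 ^ k"
            using D1 by (simp add: power2_eq_square mult_ac)
        qed (use L1 in auto)
        then show ?thesis
          using nM by (simp only: card_lessThan D_def[symmetric] L_def[symmetric])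
      qed
      fix R :: "nat set" assume R: "R \<subseteq> {..<k}"
      have finR: "finite R" and cR: "card R \<le> k"
        using R card_mono[of "{..<k}" R] by (auto intro: finite_subset)
      show "\<bar>rect_perm R ({..<n} - {c {}}) a\<bar> \<le> real n ^ card R"
        using finR card1 by (intro abs_rect_perm_le) (auto simp: a_def)
      \<comment> \<open>This keeps the loss in \<open>rect_perm_ge\<close> below 1/2, as
        \<open>card R < D\<close>, while \<open>\<beta> * n\<close> is twice
        \<open>n / (8 * D)\<close>: one half for the exceptional columns, one for the slack
        \<open>card R\<close>.\<close>
      define \<beta> where "\<beta> = 1 / (4 * D)"
      have \<beta>: "0 \<le> \<beta>" using D1 by (simp add: \<beta>_def)
      have half: "2 * \<beta> * real (card R) \<le> 1 / 2"
        using D1 cR by (simp add: \<beta>_def D_def field_simps)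
      have "(1 - 2 * \<beta> * real (card R)) * real n ^ card R \<le> rect_perm R ({..<n} - {c {}}) a"
      proof (rule rect_perm_ge[where Z = "e ` I"])
        have sub: "e ` I \<subseteq> {..<n}" by (rule e)
        \<comment> \<open>The deleted column is itself counted as exceptional, so no good column is
          lost.\<close>
        have "c {} \<in> e ` I" using cI[of "{}"] by (auto simp: c_def)
        then have "{..<n} - {c {}} - e ` I = {..<n} - e ` I" by auto
        then have "real (card ({..<n} - {c {}} - e ` I)) = real n - real (card I)"
          using sub finI e(2) \<open>card I \<le> card {..<n}\<close>
          by (simp add: card_Diff_subset card_image of_nat_diff)
        moreover have "real (card I) \<le> real n / (8 * D)"
          using cardI D1 by (simp add: field_simps)
        moreover have "real (card R) \<le> real n / (8 * D)"
        proof -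
          have "D * D * 1 * 1 \<le> D * D * 2 ^ k * L"
            using D1 L1 by (intro mult_mono) auto
          then have "8 * D * D \<le> real n"
            using nM by (simp add: power2_eq_square)
          then have "D \<le> real n / (8 * D)" using D1 by (simp add: field_simps)
          then show ?thesis using cR by (simp add: D_def)
        qed
        moreover have "\<beta> * real n = real n / (8 * D) + real n / (8 * D)"
          by (simp add: \<beta>_def)
        ultimately show "(1 - \<beta>) * real n + real (card R) \<le> real (card ({..<n} - {c {}} - e ` I))"
          by (simp add: algebra_simps)
      qed (use finR card1 \<beta> half in \<open>auto simp: a_def\<close>)
      moreover have "1 / 2 * real n ^ card R \<le> (1 - 2 * \<beta> * real (card R)) * real n ^ card R"
        using half by (intro mult_right_mono) auto
      ultimately show "real n ^ card R / 2 \<le> rect_perm R ({..<n} - {c {}}) a" by simp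
    qed simp
    moreover have "card ({..<k} - {..<l}) = k - l" using that by (simp add: card_Diff_subset)
    ultimately show ?thesis by (simp add: L_def D_def)
  qed

  \<comment> \<open>There are at most \<open>D\<close> later weights, each at most
    \<open>L * n ^ (k - l - 1)\<close>, and \<open>q * D * L < n / 2\<close>. This stays below the
    lower bound for \<open>w l\<close>.\<close>
  have dom: "real q * (\<Sum>l'\<in>{l<..k}. \<bar>w l'\<bar>) < \<bar>w l\<bar>" if "l \<le> k" for l
  proof (cases "l = k")
    case True
    then show ?thesis using w_bounds[of k] by simp
  next
    case False
    have "(\<Sum>l'\<in>{l<..k}. \<bar>w l'\<bar>) \<le> (\<Sum>l'\<in>{l<..k}. L * real n ^ (k - l - 1))"
    proof (rule sum_mono)
      fix l' assume l': "l' \<in> {l<..k}"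
      have "0 \<le> real n ^ (k - l') / 2" by simp
      then have "\<bar>w l'\<bar> \<le> L * real n ^ (k - l')" using w_bounds[of l'] l'
        by (metis abs_of_nonneg greaterThanAtMost_iff order_trans)
      also have "\<dots> \<le> L * real n ^ (k - l - 1)"
        using l' n_pos L1 by (intro mult_left_mono power_increasing) auto
      finally show "\<bar>w l'\<bar> \<le> L * real n ^ (k - l - 1)" .
    qed
    also have "\<dots> = real (k - l) * (L * real n ^ (k - l - 1))" by simp
    also have "\<dots> \<le> D * (L * real n ^ (k - l - 1))"
      using L1 by (intro mult_right_mono) (auto simp: D_def)
    finally have "real q * (\<Sum>l'\<in>{l<..k}. \<bar>w l'\<bar>)
        \<le> real q * (D * (L * real n ^ (k - l - 1)))" by (intro mult_left_mono) auto
    also have "\<dots> = real q * D * L * real n ^ (k - l - 1)" by simp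
    also have "\<dots> < real n / 2 * real n ^ (k - l - 1)"
    proof (rule mult_strict_right_mono)
      have "D * 1 * 1 \<le> D * D * 2 ^ k" using D1 by (intro mult_mono) auto
      then have "real q * D * L \<le> real q * (D\<^sup>2 * 2 ^ k) * L"
        using D1 L1 by (intro mult_mono) (auto simp: power2_eq_square)
      moreover have "8 * (real q * (D\<^sup>2 * 2 ^ k) * L) \<le> real n"
        using qM M_eq by (simp add: mult_ac)
      moreover have "0 < real q * D * L" using q1 D1 L1 by simp
      ultimately show "real q * D * L < real n / 2" using n_pos by simp
    qed (use n_pos in simp)
    also have "\<dots> = real n ^ (k - l) / 2" using False that by (simp add: power_eq_if)
    also have "\<dots> \<le> \<bar>w l\<bar>" using w_bounds[OF that] by auto
    finally show ?thesis .
  qed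

  \<comment> \<open>Exactly the first \<open>t l\<close> groups of level \<open>l\<close> count
    positively. The power of \<open>- 1\<close> is the sign from \<open>cube_diff\<close>, which
    makes each group sum to plus or minus \<open>w l\<close>.\<close>
  define x where "x t j = (if j \<in> e ` I then case g j of (l, s, X) \<Rightarrow>
      (if s < t l then 1 else - 1) * (- 1) ^ card ({..<l} - X) else (1 :: real))"
    for t :: "nat \<Rightarrow> nat" and j
  define A where "A t = mat (k + 1) n (\<lambda>(i, j). if i = k then x t j else a i j)" for t
  have A_sign: "A t \<in> sign_matrices (k + 1) n" for t
  proof -
    have "x t j = 1 \<or> x t j = - 1" for j
      by (auto simp: x_def minus_one_power_iff split: prod.splits)
    then show ?thesis by (auto simp: A_def sign_matrices_def a_def)
  qed
  \<comment> \<open>Columns with the same pattern have equal cofactors, so all groups of one level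
    share one weight.\<close>
  have Q_e: "Q (e (l, s, X)) = Q (c X)" if "(l, s, X) \<in> I" for l s X
  proof -
    have X: "X \<subseteq> {..<k}" using that by (auto simp: I_def)
    show ?thesis unfolding Q_def
      using that cI[OF X] e(1) mem[OF X]
      by (intro rect_perm_remove_column_cong) (auto simp: a_e entry[OF X])
  qed
  \<comment> \<open>At level \<open>l\<close>, \<open>t l\<close> groups count positively and
    \<open>q - t l\<close> negatively, a net \<open>2 * t l - q\<close>. Only the last sum depends
    on \<open>t\<close>.\<close>
  have perm_A: "permanent (A t) = (\<Sum>j\<in>{..<n} - e ` I. Q j) - (\<Sum>l\<le>k. real q * w l)
      + 2 * (\<Sum>l\<le>k. real (t l) * w l)" if t: "t \<in> {..k} \<rightarrow>\<^sub>E {..q}" for t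
  proof -
    let ?b = "\<lambda>i j. if i = k then x t j else a i j"
    have ins: "{..<k + 1} = insert k {..<k}" by auto
    have "permanent (A t) = rect_perm {..<k + 1} {..<n} (\<lambda>i j. A t $$ (i, j))"
      by (simp add: permanent_def rect_perm_def A_def)
    also have "\<dots> = rect_perm {..<k + 1} {..<n} ?b"
      by (intro rect_perm_cong) (auto simp: A_def)
    also have "\<dots> = (\<Sum>j<n. x t j * Q j)"
      unfolding ins Q_def
      by (subst rect_perm_insert) (auto intro!: sum.cong rect_perm_cong)
    also have "\<dots> = (\<Sum>j\<in>{..<n} - e ` I. x t j * Q j) + (\<Sum>j\<in>e ` I. x t j * Q j)"
      using e(1) by (intro sum.subset_diff) auto
    also have "(\<Sum>j\<in>{..<n} - e ` I. x t j * Q j) = (\<Sum>j\<in>{..<n} - e ` I. Q j)"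
      by (intro sum.cong) (auto simp: x_def)
    also have "(\<Sum>j\<in>e ` I. x t j * Q j) = (\<Sum>p\<in>I. x t (e p) * Q (e p))"
      by (simp add: sum.reindex[OF e(2)])
    also have "\<dots> = (\<Sum>(l, s, X)\<in>I. (if s < t l then 1 else - 1) *
        ((- 1) ^ card ({..<l} - X) * Q (c X)))"
      by (intro sum.cong) (auto simp: x_def g Q_e)
    also have "\<dots> = (\<Sum>l\<le>k. \<Sum>s<q. \<Sum>X\<in>Pow {..<l}. (if s < t l then 1 else - 1) *
        ((- 1) ^ card ({..<l} - X) * Q (c X)))"
      unfolding I_def by (simp add: sum.Sigma[symmetric] sum.cartesian_product[symmetric])
    also have "\<dots> = (\<Sum>l\<le>k. (2 * real (t l) - real q) * w l)"
    proof (intro sum.cong refl)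
      fix l assume l: "l \<in> {..k}"
      have tl: "t l \<le> q" using PiE_mem[OF t l] by simp
      then have split: "{..<q} = {..<t l} \<union> {t l..<q}" by auto
      have "(\<Sum>s<q. if s < t l then 1 else - 1 :: real) = real (t l) - (real q - real (t l))"
        using tl by (subst split, subst sum.union_disjoint) (auto simp: of_nat_diff)
      then have "(\<Sum>s<q. (if s < t l then 1 else - 1) * w l) = (2 * real (t l) - real q) * w l"
        by (simp flip: sum_distrib_right)
      then show "(\<Sum>s<q. \<Sum>X\<in>Pow {..<l}. (if s < t l then 1 else - 1) *
          ((- 1) ^ card ({..<l} - X) * Q (c X))) = (2 * real (t l) - real q) * w l"
        by (simp add: w_def cube_diff_def Q_def flip: sum_distrib_left)
    qed
    also have "\<dots> = 2 * (\<Sum>l\<le>k. real (t l) * w l) - (\<Sum>l\<le>k. real q * w l)"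
      by (simp add: left_diff_distrib sum_subtractf sum_distrib_left mult.assoc)
    finally show ?thesis by simp
  qed
  let ?T = "{..k} \<rightarrow>\<^sub>E {..q}"
  have inj: "inj_on (\<lambda>t. permanent (A t)) ?T"
  proof (rule inj_onI)
    fix t u assume tu: "t \<in> ?T" "u \<in> ?T" and "permanent (A t) = permanent (A u)"
    then have eq: "(\<Sum>l\<le>k. real (t l) * w l) = (\<Sum>l\<le>k. real (u l) * w l)"
      by (simp add: perm_A)
    show "t = u" by (rule mixed_radix_inj[OF dom tu eq])
  qed
  have fin: "finite (sign_matrices (k + 1) n)"
    by (rule finite_sign_matrices)
  have "(q + 1) ^ (k + 1) = card ?T" by (simp add: card_PiE)
  also have "\<dots> = card ((\<lambda>t. permanent (A t)) ` ?T)" using inj by (simp add: card_image)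
  also have "\<dots> \<le> num_permanents (k + 1) n"
    unfolding num_permanents_def using fin A_sign by (intro card_mono) auto
  finally have card_ge: "(q + 1) ^ (k + 1) \<le> num_permanents (k + 1) n" .
  \<comment> \<open>The digits run from 0 to \<open>q\<close>; the extra value makes up for the
    rounding in \<open>n div M\<close>.\<close>
  have "n < (q + 1) * M"
    unfolding q_def using M_pos dividend_less_div_times[of M n] by (simp add: algebra_simps)
  then have "real n < real (q + 1) * real M"
    unfolding of_nat_mult[symmetric] of_nat_less_iff .
  then have "real n / real M \<le> real (q + 1)"
    using M_pos by (simp add: field_simps)
  then have "(real n / real M) ^ (k + 1) \<le> real (q + 1) ^ (k + 1)"
    by (intro power_mono) auto
  also have "\<dots> \<le> real (num_permanents (k + 1) n)"
    unfolding of_nat_power[symmetric] of_nat_le_iff by (rule card_ge)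
  finally show ?thesis .
qed

section \<open>From large \<open>n\<close> to all \<open>n\<close> from \<open>k + 1\<close>
  on\<close>

theorem theorem1:
  "\<forall>k::nat. k \<ge> 1 \<longrightarrow>
     (\<exists>\<epsilon>::real. \<epsilon> > 0 \<and>
        (\<forall>n::nat. n \<ge> k + 1 \<longrightarrow>
           real (num_permanents (k + 1) n) \<ge> \<epsilon> * real n powi (int k - 2)))"
proof (intro allI impI)
  fix k :: nat assume "k \<ge> 1"
  define M where "M = 8 * (k + 1)\<^sup>2 * 2 ^ k * (3 * (k + 1)) ^ k"
  have M: "M > 0" by (simp add: M_def)
  show "\<exists>\<epsilon>::real. \<epsilon> > 0 \<and> (\<forall>n::nat. n \<ge> k + 1 \<longrightarrow>
           real (num_permanents (k + 1) n) \<ge> \<epsilon> * real n powi (int k - 2))"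
  proof (intro exI conjI allI impI)
    \<comment> \<open>This constant turns \<open>n ^ (k + 1)\<close> into
      \<open>(n / M) ^ (k + 1)\<close>, which is at most 1 for \<open>n < M\<close>, where a single
      permanent is enough.\<close>
    show "0 < 1 / real M ^ (k + 1)" using M by simp
  next
    fix n :: nat assume n: "n \<ge> k + 1"
    \<comment> \<open>The exponent is \<open>- 1\<close> for \<open>k = 1\<close>, hence the integer
      power; it is monotone in the exponent since \<open>n\<close> is at least 1.\<close>
    have "real n powi (int k - 2) \<le> real n powi int (k + 1)"
      using n by (intro power_int_increasing) auto
    then have "1 / real M ^ (k + 1) * real n powi (int k - 2)
        \<le> 1 / real M ^ (k + 1) * real n ^ (k + 1)"
      by (intro mult_left_mono) (simp_all only: power_int_of_nat, auto)
    also have "\<dots> = (real n / real M) ^ (k + 1)" by (simp only: power_divide) simp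
    also have "\<dots> \<le> real (num_permanents (k + 1) n)"
    proof (cases "M \<le> n")
      case True
      then show ?thesis using num_permanents_ge[of k n] by (simp only: M_def)
    next
      case False
      then have "(real n / real M) ^ (k + 1) \<le> 1" by (intro power_le_one) auto
      also have "1 \<le> real (num_permanents (k + 1) n)" using num_permanents_pos[OF n] by linarith
      finally show ?thesis .
    qed
    finally show "1 / real M ^ (k + 1) * real n powi (int k - 2)
        \<le> real (num_permanents (k + 1) n)" .
  qed
qed

end
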